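(* For $(x,T)\in X\times\mathbb{N}^0$ let $\langle y_t\mid t\ge T\rangle\in\mathcal{S}^T(x)$. Then there exists an infinite sequence $\langle(\lambda_t,\mu_t,\gamma_t)\mid t>T\rangle$ in $\mathbb{R}_+^3$ such that for all $t>T$ and all $y\in\Omega_{t-1}(y_{t-1})$ satisfying $(y,y_{t+1})\in\Omega_t$: (i) $\lambda_t y\le \lambda_t c_{t-1}+\lambda_t a_{t-1}y_{t-1}=\lambda_t y_t$; (ii) $-\mu_t a_t y\le \mu_t c_t-\mu_t y_{t+1}=-\mu_t a_t y_t$; (iii) $\gamma_t y\le \gamma_t b=\gamma_t y_t$; (iv) $\lambda_t-a_t\mu_t+\gamma_t\ge p^{(t)}$; and (v) $\lambda_t y_t-a_t\mu_t y_t+\gamma_t y_t=p^{(t)}y_t$. Further, $\lim_{t\to\infty}(\lambda_t-\mu_t a_t+\gamma_t)y_t=0$.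
   Context: $\mathbb{N}$ is the set of strictly positive integers, $\mathbb{N}^0=\mathbb{N}\cup\{0\}$, and $\mathbb{R}_+$ is the set of non-negative reals. Fix a real number $b>0$ and let $X=[0,b]\subset\mathbb{R}$. A linear dynamic optimization problem with linear constraints (LDO-LC problem) $\langle(p^{(t)},c_t,a_t)\mid t\in\mathbb{N}^0\rangle$ is given by real sequences with $c_t\ge 0$ and $c_t+a_tb\ge 0$ for all $t\in\mathbb{N}^0$, $\sum_{t=0}^\infty|c_t|<+\infty$, $\sum_{t=0}^\infty|a_t|<+\infty$ and $\sum_{t=0}^\infty|p^{(t)}|<+\infty$. (These imply $c_t+a_tx\ge 0$ for all $x\in X$.) Throughout such a problem is given. For $t\in\mathbb{N}^0$, let $\Omega_t=\{(x,y)\in X\times X\mid y\le c_t+a_tx\}$ and, for $x\in X$, $\Omega_t(x)=\{y\in[0,b]\mid y\le c_t+a_tx\}=[0,\min\{c_t+a_tx,b\}]$. For $x\in X$ and $T\in\mathbb{N}^0$, $\mathcal{F}^T(x)$ is the set of trajectories starting at $x$ at time-period $T$, i.e. of all sequences $\langle x_t\mid t\ge T\rangle$ in $X$ with $x_T=x$ and $x_{t+1}\in\Omega_t(x_t)$ for all $t\ge T$; and $\mathcal{S}^T(x)=\operatorname{argmax}_{\langle x_t\mid t\ge T\rangle\in\mathcal{F}^T(x)}\sum_{t=T}^\infty p^{(t)}x_t$ is the set of optimal trajectories beginning at $x$ at time-period $T$. *)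

theory Defs
  imports Complex_Main "HOL-Library.FuncSet"
begin

locale ldo_lc =
  fixes b :: real and p c a :: "nat \<Rightarrow> real"
  assumes b_pos: "b > 0"
    and c_nonneg: "\<And>t. c t \<ge> 0"
    and c_a_nonneg: "\<And>t. c t + a t * b \<ge> 0"
    and summable_c: "summable (\<lambda>t. \<bar>c t\<bar>)"
    and summable_a: "summable (\<lambda>t. \<bar>a t\<bar>)"
    and summable_p: "summable (\<lambda>t. \<bar>p t\<bar>)"

definition Omega :: "real \<Rightarrow> (nat \<Rightarrow> real) \<Rightarrow> (nat \<Rightarrow> real) \<Rightarrow> nat \<Rightarrow> (real \<times> real) set" where
  "Omega b c a t = {(x, y). x \<in> {0..b} \<and> y \<in> {0..b} \<and> y \<le> c t + a t * x}"

definition Omega_at :: "real \<Rightarrow> (nat \<Rightarrow> real) \<Rightarrow> (nat \<Rightarrow> real) \<Rightarrow> nat \<Rightarrow> real \<Rightarrow> real set" where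
  "Omega_at b c a t x = {y \<in> {0..b}. y \<le> c t + a t * x}"

(* A sequence indexed by the periods t >= T is a function on nat; its values at
   t < T are unconstrained and are never used. *)
definition trajectories ::
  "real \<Rightarrow> (nat \<Rightarrow> real) \<Rightarrow> (nat \<Rightarrow> real) \<Rightarrow> nat \<Rightarrow> real \<Rightarrow> (nat \<Rightarrow> real) set" where
  "trajectories b c a T x =
     {xs \<in> {T..} \<rightarrow> {0..b}. xs T = x \<and> (\<forall>t\<ge>T. xs (Suc t) \<in> Omega_at b c a t (xs t))}"

(* The sum over all t >= T, reindexed; it converges for every sequence in [0, b]
   because the p t are absolutely summable. *)
definition total_payoff :: "(nat \<Rightarrow> real) \<Rightarrow> nat \<Rightarrow> (nat \<Rightarrow> real) \<Rightarrow> real" where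
  "total_payoff p T xs = (\<Sum>k. p (T + k) * xs (T + k))"

definition optimal_trajectories ::
  "real \<Rightarrow> (nat \<Rightarrow> real) \<Rightarrow> (nat \<Rightarrow> real) \<Rightarrow> (nat \<Rightarrow> real) \<Rightarrow> nat \<Rightarrow> real \<Rightarrow> (nat \<Rightarrow> real) set" where
  "optimal_trajectories b p c a T x =
     {xs. is_arg_max (total_payoff p T) (\<lambda>ys. ys \<in> trajectories b c a T x) xs}"

end

theory Submission
  imports Defs
begin

text \<open>
  Changing an optimal trajectory at a single period \<open>t > T\<close> cannot increase the payoff, so
  \<open>y t\<close> maximises the linear function \<open>z \<mapsto> p t * z\<close> over the
  interval of all \<open>z\<close> compatible with the neighbours \<open>y (t - 1)\<close> and
  \<open>y (t + 1)\<close>. The multipliers are those of this one-dimensional linear program, so the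
  periods decouple. By complementary slackness the transversality sequence is
  \<open>p t * y t\<close>, which tends to \<open>0\<close> because \<open>p\<close> is
  summable and \<open>y\<close> is bounded.
\<close>

text \<open>Linear programming duality for one variable: \<open>l\<close>, \<open>m\<close>,
  \<open>g\<close> price the constraints \<open>z \<le> k\<close>, \<open>w \<le> c + a * z\<close>,
  \<open>z \<le> b\<close>. The bound \<open>0 \<le> z\<close> gets no multiplier, so stationarity
  is an inequality that becomes an equality after multiplication by \<open>v\<close>.\<close>

lemma one_dim_lp_multipliers:
  fixes a b c k p v w :: real
  assumes v: "0 \<le> v" "v \<le> b" "v \<le> k" "w \<le> c + a * v"
    and opt: "\<And>z. 0 \<le> z \<Longrightarrow> z \<le> b \<Longrightarrow> z \<le> k \<Longrightarrow> w \<le> c + a * z \<Longrightarrow> p * z \<le> p * v"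
  shows "\<exists>l m g. l \<ge> 0 \<and> m \<ge> 0 \<and> g \<ge> 0 \<and> l * k = l * v \<and> m * w = m * (c + a * v) \<and>
    g * b = g * v \<and> l - a * m + g \<ge> p \<and> (l - a * m + g) * v = p * v"
proof -
  consider (zero) "p = 0 \<or> (p < 0 \<and> v = 0)" | (pos) "p > 0" | (neg) "p < 0" "v > 0"
    using v by linarith
  then show ?thesis
  proof cases
    case zero
    \<comment> \<open>All multipliers vanish; if \<open>p < 0\<close>, the unpriced bound
      \<open>0 \<le> z\<close> is the active one.\<close>
    then show ?thesis
      by (intro exI[of _ 0]) auto
  next
    case pos
    \<comment> \<open>For \<open>p > 0\<close> something must stop \<open>v\<close> from moving
      right. The constraint \<open>w \<le> c + a * z\<close> bounds \<open>z\<close> from above only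
      if \<open>a < 0\<close>.\<close>
    have "v = k \<or> v = b \<or> (a < 0 \<and> w = c + a * v)"
    proof (rule ccontr)
      assume "\<not> ?thesis"
      then have less: "v < k" "v < b" and slack: "a < 0 \<Longrightarrow> w < c + a * v"
        using v by auto
      \<comment> \<open>The longest feasible move to the right; for \<open>a \<ge> 0\<close> the
        constraint with \<open>w\<close> allows any such move, and 1 is a dummy value.\<close>
      define e where "e = min (min (k - v) (b - v)) (if a < 0 then (c + a * v - w) / - a else 1)"
      have e: "e > 0" "e \<le> k - v" "e \<le> b - v"
        using less slack by (auto simp: e_def intro: divide_pos_neg divide_neg_neg)
      have "w \<le> c + a * (v + e)"
      proof (cases "a < 0")
        case True
        then have "e \<le> (c + a * v - w) / - a"
          by (simp add: e_def)
        then have "e * - a \<le> c + a * v - w"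
          using True by (subst (asm) pos_le_divide_eq) auto
        then show ?thesis
          by (simp add: algebra_simps)
      next
        case False
        then have "a * e \<ge> 0"
          using e by simp
        then show ?thesis
          using v by (simp add: algebra_simps)
      qed
      then have "p * (v + e) \<le> p * v"
        using e v by (intro opt) auto
      then show False
        using pos e by simp
    qed
    \<comment> \<open>One active constraint carries all of \<open>p\<close>, so that
      \<open>l - a * m + g = p\<close>; in the third case this forces \<open>m = - p / a\<close>,
      which is positive.\<close>
    then consider "v = k" | "v = b" | "a < 0" "w = c + a * v"
      by blast
    then show ?thesis
    proof cases
      case 1
      then show ?thesis
        using pos by (intro exI[of _ p] exI[of _ 0]) auto
    next
      case 2
      show ?thesis
        by (rule exI[of _ 0], rule exI[of _ 0], rule exI[of _ p]) (use pos 2 in auto)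
    next
      case 3
      show ?thesis
        by (rule exI[of _ 0], rule exI[of _ "- p / a"], rule exI[of _ 0])
          (use pos 3 in \<open>auto simp: divide_le_0_iff\<close>)
    qed
  next
    case neg
    \<comment> \<open>Now \<open>v\<close> wants to move left and \<open>v > 0\<close> leaves room,
      so only \<open>w \<le> c + a * z\<close> with \<open>a > 0\<close> can block it.\<close>
    have tight: "a > 0 \<and> w = c + a * v"
    proof (rule ccontr)
      assume "\<not> ?thesis"
      then have slack: "a > 0 \<Longrightarrow> w < c + a * v"
        using v by auto
      define e where "e = min v (if a > 0 then (c + a * v - w) / a else 1)"
      have e: "e > 0" "e \<le> v"
        using neg slack by (auto simp: e_def)
      have "w \<le> c + a * (v - e)"
      proof (cases "a > 0")
        case True
        then have "e \<le> (c + a * v - w) / a"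
          by (simp add: e_def)
        then have "e * a \<le> c + a * v - w"
          using True by (simp add: pos_le_divide_eq)
        then show ?thesis
          by (simp add: algebra_simps)
      next
        case False
        then have "a * e \<le> 0"
          using e by (simp add: mult_nonpos_nonneg)
        then show ?thesis
          using v by (simp add: algebra_simps)
      qed
      then have "p * (v - e) \<le> p * v"
        using e v by (intro opt) auto
      then have "p * e \<ge> 0"
        by (simp add: algebra_simps)
      then show False
        using neg e by (simp add: zero_le_mult_iff)
    qed
    \<comment> \<open>Again \<open>- a * m = p\<close>, with \<open>m > 0\<close> because
      \<open>p\<close> and \<open>a\<close> have opposite signs.\<close>
    show ?thesis
      by (rule exI[of _ 0], rule exI[of _ "- p / a"], rule exI[of _ 0])
        (use neg tight in \<open>auto simp: divide_nonpos_pos\<close>)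
  qed
qed

lemma summable_mult_bounded_tail:
  fixes p xs :: "nat \<Rightarrow> real"
  assumes "summable (\<lambda>t. \<bar>p t\<bar>)" and "xs \<in> {T..} \<rightarrow> {0..b}"
  shows "summable (\<lambda>k. p (T + k) * xs (T + k))"
proof (rule summable_comparison_test')
  have "summable (\<lambda>k. \<bar>p (k + T)\<bar>)"
    using assms(1) by (subst summable_iff_shift)
  then show "summable (\<lambda>k. b * \<bar>p (T + k)\<bar>)"
    by (intro summable_mult) (simp add: add.commute)
  show "norm (p (T + k) * xs (T + k)) \<le> b * \<bar>p (T + k)\<bar>" if "k \<ge> 0" for k
  proof -
    have "xs (T + k) \<in> {0..b}"
      using assms(2) by (auto simp: Pi_iff)
    then show ?thesis
      by (simp add: abs_mult mult.commute mult_right_mono)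
  qed
qed

lemma total_payoff_fun_upd:
  assumes "summable (\<lambda>k. p (T + k) * xs (T + k))" and "T \<le> t"
  shows "total_payoff p T (xs(t := z)) = total_payoff p T xs + p t * (z - xs t)"
proof -
  \<comment> \<open>The change in payoff as a series with one term. The payoff is reindexed from
    \<open>T\<close>, so period \<open>t\<close> sits at index \<open>t - T\<close>;
    \<open>T \<le> t\<close> rules out truncated subtraction.\<close>
  define d where "d k = (if k = t - T then p t * (z - xs t) else 0)" for k
  have "d sums (p t * (z - xs t))"
    unfolding d_def by (rule sums_single)
  moreover have "(\<lambda>k. p (T + k) * xs (T + k)) sums total_payoff p T xs"
    unfolding total_payoff_def using assms(1) by (rule summable_sums)
  ultimately have "(\<lambda>k. p (T + k) * xs (T + k) + d k) sums
      (total_payoff p T xs + p t * (z - xs t))"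
    by (intro sums_add)
  moreover have "p (T + k) * xs (T + k) + d k = p (T + k) * (xs(t := z)) (T + k)" for k
    using assms(2) by (auto simp: d_def algebra_simps)
  ultimately show ?thesis
    unfolding total_payoff_def by (simp add: sums_iff)
qed

text \<open>Only the transitions into and out of period \<open>t\<close> see the new value. As
  \<open>T < t\<close>, the initial value is untouched and period \<open>t - 1\<close> belongs to
  the trajectory.\<close>

lemma trajectories_fun_upd:
  assumes xs: "xs \<in> trajectories b c a T x" and "T < t"
    and z: "z \<in> Omega_at b c a (t - 1) (xs (t - 1))" and "(z, xs (t + 1)) \<in> Omega b c a t"
  shows "xs(t := z) \<in> trajectories b c a T x"
proof -
  have "(xs(t := z)) (Suc s) \<in> Omega_at b c a s ((xs(t := z)) s)" if "T \<le> s" for s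
    using assms that by (auto simp: trajectories_def Omega_at_def Omega_def)
  moreover have "xs(t := z) \<in> {T..} \<rightarrow> {0..b}"
    using xs z by (auto simp: trajectories_def Omega_at_def)
  ultimately show ?thesis
    using xs \<open>T < t\<close> by (simp add: trajectories_def)
qed

lemma optimal_trajectories_one_period:
  assumes p: "summable (\<lambda>t. \<bar>p t\<bar>)" and y: "y \<in> optimal_trajectories b p c a T x" and "T < t"
    and "z \<in> Omega_at b c a (t - 1) (y (t - 1))" and "(z, y (t + 1)) \<in> Omega b c a t"
  shows "p t * z \<le> p t * y t"
proof -
  have traj: "y \<in> trajectories b c a T x"
    and max: "\<And>ys. ys \<in> trajectories b c a T x \<Longrightarrow> total_payoff p T ys \<le> total_payoff p T y"
    using y by (auto simp: optimal_trajectories_def is_arg_max_linorder)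
  have "y(t := z) \<in> trajectories b c a T x"
    using traj assms(3-5) by (rule trajectories_fun_upd)
  then have "total_payoff p T (y(t := z)) \<le> total_payoff p T y"
    by (rule max)
  moreover have "summable (\<lambda>k. p (T + k) * y (T + k))"
    using p traj by (intro summable_mult_bounded_tail) (auto simp: trajectories_def)
  ultimately show ?thesis
    using \<open>T < t\<close> by (simp add: total_payoff_fun_upd algebra_simps)
qed

theorem proposition6:
  fixes b x :: real and p c a y :: "nat \<Rightarrow> real" and T :: nat
  assumes "ldo_lc b p c a"
    and "x \<in> {0..b}"
    and "y \<in> optimal_trajectories b p c a T x"
  shows "\<exists>l m g :: nat \<Rightarrow> real.
    (\<forall>t>T. l t \<ge> 0 \<and> m t \<ge> 0 \<and> g t \<ge> 0) \<and>
    (\<forall>t>T. \<forall>z \<in> Omega_at b c a (t - 1) (y (t - 1)). (z, y (t + 1)) \<in> Omega b c a t \<longrightarrow>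
       (l t * z \<le> l t * c (t - 1) + l t * a (t - 1) * y (t - 1) \<and>
        l t * c (t - 1) + l t * a (t - 1) * y (t - 1) = l t * y t) \<and>
       (- m t * a t * z \<le> m t * c t - m t * y (t + 1) \<and>
        m t * c t - m t * y (t + 1) = - m t * a t * y t) \<and>
       (g t * z \<le> g t * b \<and> g t * b = g t * y t) \<and>
       l t - a t * m t + g t \<ge> p t \<and>
       l t * y t - a t * m t * y t + g t * y t = p t * y t) \<and>
    (\<lambda>t. (l t - m t * a t + g t) * y t) \<longlonglongrightarrow> 0"
proof -
  have p: "summable (\<lambda>t. \<bar>p t\<bar>)"
    using assms(1) by (simp add: ldo_lc_def)
  have y: "y \<in> {T..} \<rightarrow> {0..b}"
    and step: "\<And>t. T \<le> t \<Longrightarrow> y (Suc t) \<in> Omega_at b c a t (y t)"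
    using assms(3) by (auto simp: optimal_trajectories_def is_arg_max_def trajectories_def)
  \<comment> \<open>The condition \<open>T < t\<close> stands inside the existentials so that choice
    yields sequences on all of \<open>nat\<close>, arbitrary up to \<open>T\<close>.\<close>
  have "\<forall>t. \<exists>l m g. T < t \<longrightarrow> l \<ge> 0 \<and> m \<ge> 0 \<and> g \<ge> 0 \<and>
      l * (c (t - 1) + a (t - 1) * y (t - 1)) = l * y t \<and>
      m * y (t + 1) = m * (c t + a t * y t) \<and> g * b = g * y t \<and>
      l - a t * m + g \<ge> p t \<and> (l - a t * m + g) * y t = p t * y t"
  proof
    fix t
    show "\<exists>l m g. T < t \<longrightarrow> l \<ge> 0 \<and> m \<ge> 0 \<and> g \<ge> 0 \<and>
      l * (c (t - 1) + a (t - 1) * y (t - 1)) = l * y t \<and>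
      m * y (t + 1) = m * (c t + a t * y t) \<and> g * b = g * y t \<and>
      l - a t * m + g \<ge> p t \<and> (l - a t * m + g) * y t = p t * y t"
    proof (cases "T < t")
      case True
      then have "y t \<in> Omega_at b c a (t - 1) (y (t - 1))"
          and nxt: "y (t + 1) \<in> Omega_at b c a t (y t)"
        using step[of "t - 1"] step[of t] by auto
      moreover have "p t * z \<le> p t * y t"
        if "0 \<le> z" "z \<le> b" "z \<le> c (t - 1) + a (t - 1) * y (t - 1)" "y (t + 1) \<le> c t + a t * z"
        for z
        using that nxt True
        by (intro optimal_trajectories_one_period[OF p assms(3)]) (auto simp: Omega_def Omega_at_def)
      ultimately show ?thesis
        using one_dim_lp_multipliers[of "y t" b "c (t - 1) + a (t - 1) * y (t - 1)"
            "y (t + 1)" "c t" "a t" "p t"]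
        by (auto simp: Omega_at_def)
    qed simp
  qed
  then obtain l m g where lmg: "\<And>t. T < t \<Longrightarrow> l t \<ge> 0 \<and> m t \<ge> 0 \<and> g t \<ge> 0 \<and>
      l t * (c (t - 1) + a (t - 1) * y (t - 1)) = l t * y t \<and>
      m t * y (t + 1) = m t * (c t + a t * y t) \<and> g t * b = g t * y t \<and>
      l t - a t * m t + g t \<ge> p t \<and> (l t - a t * m t + g t) * y t = p t * y t"
    by (auto simp only: choice_iff)
  have "(\<lambda>k. p (T + k) * y (T + k)) \<longlonglongrightarrow> 0"
    using p y by (intro summable_LIMSEQ_zero summable_mult_bounded_tail)
  then have "(\<lambda>t. p t * y t) \<longlonglongrightarrow> 0"
    using LIMSEQ_offset[of "\<lambda>t. p t * y t" T] by (simp add: add.commute)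
  \<comment> \<open>The multipliers are controlled only beyond \<open>T\<close>, so the two
    sequences agree eventually, which suffices for the limit.\<close>
  moreover have "p t * y t = (l t - m t * a t + g t) * y t" if "T < t" for t
    using lmg[OF that] by (auto simp: mult.commute[of "m t"])
  then have "eventually (\<lambda>t. p t * y t = (l t - m t * a t + g t) * y t) sequentially"
    by (rule eventually_mono[OF eventually_gt_at_top[of T]])
  ultimately have lim: "(\<lambda>t. (l t - m t * a t + g t) * y t) \<longlonglongrightarrow> 0"
    by (rule Lim_transform_eventually)
  have cond: "(l t * z \<le> l t * c (t - 1) + l t * a (t - 1) * y (t - 1) \<and>
        l t * c (t - 1) + l t * a (t - 1) * y (t - 1) = l t * y t) \<and>
       (- m t * a t * z \<le> m t * c t - m t * y (t + 1) \<and>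
        m t * c t - m t * y (t + 1) = - m t * a t * y t) \<and>
       (g t * z \<le> g t * b \<and> g t * b = g t * y t) \<and>
       l t - a t * m t + g t \<ge> p t \<and>
       l t * y t - a t * m t * y t + g t * y t = p t * y t"
    if t: "T < t" and z: "z \<in> Omega_at b c a (t - 1) (y (t - 1))" "(z, y (t + 1)) \<in> Omega b c a t"
    for t z
  proof -
    \<comment> \<open>The inequalities in \<open>z\<close> are its feasibility constraints times
      nonnegative multipliers; the equalities at \<open>y t\<close> are the slackness relations in
      \<open>lmg\<close>.\<close>
    have "l t * z \<le> l t * (c (t - 1) + a (t - 1) * y (t - 1))"
        "m t * y (t + 1) \<le> m t * (c t + a t * z)" "g t * z \<le> g t * b"
      using lmg[OF t] z by (auto simp: Omega_at_def Omega_def intro!: mult_left_mono)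
    then show ?thesis
      using lmg[OF t] by (auto simp: algebra_simps)
  qed
  show ?thesis
    by (rule exI[of _ l], rule exI[of _ m], rule exI[of _ g],
        intro conjI[OF _ conjI[OF _ lim]] allI impI ballI)
      (use lmg in blast, rule cond)
qed

end
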